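(* For every positive integer $t$, the class of graphs with no vertex-minor isomorphic to the path $P_t$ on $t$ vertices is linearly $\chi$-bounded; that is, there is a linear function $f$ such that $\chi(H)\le f(\omega(H))$ for every graph $H$ with no vertex-minor isomorphic to $P_t$.
   Context: Graphs are finite and simple. $\chi(G)$ is the chromatic number and $\omega(G)$ the clique number of $G$. A class $\mathcal C$ is $\chi$-bounded if there is a function $f$ with $\chi(H)\le f(\omega(H))$ for all induced subgraphs $H$ of graphs in $\mathcal C$, and linearly $\chi$-bounded if $f$ can be taken linear (note the class in question is closed under induced subgraphs). Local complementation at $v$ gives $G*v$ with edge set $E(G)\,\Delta\,\{xy:x,y\in N_G(v),x\ne y\}$; $H$ is a vertex-minor of $G$ if $H$ is an induced subgraph of a graph obtained from $G$ by a sequence of local complementations. *)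

theory Defs
  imports Complex_Main
begin

text \<open>Edges are two-element sets of vertices. The null graph is allowed.\<close>

datatype 'a graph = Graph (verts: "'a set") (edges: "'a set set")

definition fin_simple_graph :: "'a graph \<Rightarrow> bool" where
  "fin_simple_graph G \<longleftrightarrow>
     finite (verts G) \<and> (\<forall>e\<in>edges G. e \<subseteq> verts G \<and> card e = 2)"

definition adjacent :: "'a graph \<Rightarrow> 'a \<Rightarrow> 'a \<Rightarrow> bool" where
  "adjacent G x y \<longleftrightarrow> {x, y} \<in> edges G"

definition neighborhood :: "'a graph \<Rightarrow> 'a \<Rightarrow> 'a set" where
  "neighborhood G v = {x. adjacent G v x}"

definition induce :: "'a graph \<Rightarrow> 'a set \<Rightarrow> 'a graph" where
  "induce G S = Graph S {e \<in> edges G. e \<subseteq> S}"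

definition induced_subgraph :: "'a graph \<Rightarrow> 'a graph \<Rightarrow> bool" where
  "induced_subgraph H G \<longleftrightarrow> (\<exists>S \<subseteq> verts G. H = induce G S)"

definition graph_iso :: "'a graph \<Rightarrow> 'b graph \<Rightarrow> bool" where
  "graph_iso G H \<longleftrightarrow>
     (\<exists>\<phi>. bij_betw \<phi> (verts G) (verts H) \<and>
          (\<forall>x\<in>verts G. \<forall>y\<in>verts G. adjacent G x y \<longleftrightarrow> adjacent H (\<phi> x) (\<phi> y)))"

definition local_complement :: "'a graph \<Rightarrow> 'a \<Rightarrow> 'a graph" where
  "local_complement G v =
     Graph (verts G)
       (sym_diff (edges G)
          {{x, y} | x y. x \<in> neighborhood G v \<and> y \<in> neighborhood G v \<and> x \<noteq> y})"

inductive locally_equivalent :: "'a graph \<Rightarrow> 'a graph \<Rightarrow> bool" for G where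
  refl: "locally_equivalent G G"
| step: "locally_equivalent G G' \<Longrightarrow> v \<in> verts G'
          \<Longrightarrow> locally_equivalent G (local_complement G' v)"

definition vertex_minor :: "'a graph \<Rightarrow> 'a graph \<Rightarrow> bool" where
  "vertex_minor H G \<longleftrightarrow> (\<exists>G'. locally_equivalent G G' \<and> induced_subgraph H G')"

definition path_graph :: "nat \<Rightarrow> nat graph" where
  "path_graph t = Graph {..<t} {{i, Suc i} | i. Suc i < t}"

definition colorable :: "'a graph \<Rightarrow> nat \<Rightarrow> bool" where
  "colorable G k \<longleftrightarrow>
     (\<exists>c :: 'a \<Rightarrow> nat. c ` verts G \<subseteq> {..<k} \<and>
        (\<forall>x\<in>verts G. \<forall>y\<in>verts G. adjacent G x y \<longrightarrow> c x \<noteq> c y))"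

definition chromatic_number :: "'a graph \<Rightarrow> nat" where
  "chromatic_number G = (LEAST k. colorable G k)"

definition is_clique :: "'a graph \<Rightarrow> 'a set \<Rightarrow> bool" where
  "is_clique G K \<longleftrightarrow>
     K \<subseteq> verts G \<and> (\<forall>x\<in>K. \<forall>y\<in>K. x \<noteq> y \<longrightarrow> adjacent G x y)"

definition clique_number :: "'a graph \<Rightarrow> nat" where
  "clique_number G = Max (card ` {K. is_clique G K})"

definition chi_bounding_function :: "(nat \<Rightarrow> real) \<Rightarrow> 'a graph set \<Rightarrow> bool" where
  "chi_bounding_function f \<C> \<longleftrightarrow>
     (\<forall>G\<in>\<C>. \<forall>H. induced_subgraph H G \<longrightarrow> real (chromatic_number H) \<le> f (clique_number H))"

text \<open>Homogeneous linear functions suffice: an affine bound \<open>a * n + b\<close> is at most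
  \<open>(\<bar>a\<bar> + \<bar>b\<bar>) * n\<close> for \<open>n \<ge> 1\<close>, and the null graph has chromatic and clique number 0.\<close>

definition linearly_chi_bounded :: "'a graph set \<Rightarrow> bool" where
  "linearly_chi_bounded \<C> \<longleftrightarrow>
     (\<exists>f. (\<exists>c. \<forall>n. f n = c * real n) \<and> chi_bounding_function f \<C>)"

text \<open>Vertices are drawn from an arbitrary type. Taking it to be \<open>nat\<close> covers all finite
  graphs up to isomorphism, with a single bounding function.\<close>

definition vertex_minor_free_graphs :: "'b graph \<Rightarrow> 'a graph set" where
  "vertex_minor_free_graphs F =
     {G. fin_simple_graph G \<and> \<not> (\<exists>H. vertex_minor H G \<and> graph_iso H F)}"

end

theory Submission
  imports Defs
begin

text \<open>
  If the vertex set can be partitioned into \<open>k\<close> cographs, then \<open>\<chi> \<le> k \<omega>\<close>, because cographs are perfect;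
  so it suffices to bound the number of cographs needed in terms of \<open>t\<close> alone. Call a set large if it
  needs many cographs. Complementation does not affect this notion.

  Split a large set \<open>S\<close> into the neighbours and the non-neighbours of some \<open>v\<close>. Suppose that the
  non-neighbours are large. Either some non-neighbour of \<open>v\<close> is complete to a large set of
  non-neighbours, which then is anticomplete to \<open>v\<close>, or all neighbourhoods inside are small and
  Gyarfas' path argument gives a long induced path. If the neighbours of \<open>v\<close> are large, the same
  argument in the complement gives vertices as before or a long induced copath complete to \<open>v\<close>,
  which the local complementation at \<open>v\<close> turns into a path.

  Thus in the remaining case every large set has one vertex complete and one anticomplete to a still
  large subset. Iterating, there are vertices \<open>x\<^sub>1, \<dots>, x\<^sub>t\<close> that are alternately complete and
  anticomplete to all their successors, and local complementations at \<open>x\<^sub>1, \<dots>, x\<^sub>t\<close>, in this order,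
  turn them into an induced path.
\<close>

section \<open>Complementation and perfection of cographs\<close>

definition co_rel :: "('a \<Rightarrow> 'a \<Rightarrow> bool) \<Rightarrow> 'a \<Rightarrow> 'a \<Rightarrow> bool" where
  "co_rel E x y \<longleftrightarrow> x \<noteq> y \<and> \<not> E x y"

lemma symp_co_rel: "symp E \<Longrightarrow> symp (co_rel E)"
  by (auto simp: symp_def co_rel_def)

inductive cograph_on :: "('a \<Rightarrow> 'a \<Rightarrow> bool) \<Rightarrow> 'a set \<Rightarrow> bool" for E where
  empty: "cograph_on E {}"
| singleton: "cograph_on E {x}"
| union: "cograph_on E A \<Longrightarrow> cograph_on E B \<Longrightarrow> A \<inter> B = {} \<Longrightarrow>
    (\<And>a b. a \<in> A \<Longrightarrow> b \<in> B \<Longrightarrow> \<not> E a b) \<Longrightarrow> cograph_on E (A \<union> B)"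
| join: "cograph_on E A \<Longrightarrow> cograph_on E B \<Longrightarrow> A \<inter> B = {} \<Longrightarrow>
    (\<And>a b. a \<in> A \<Longrightarrow> b \<in> B \<Longrightarrow> E a b) \<Longrightarrow> cograph_on E (A \<union> B)"

lemma cograph_on_subset:
  assumes "cograph_on E S" "T \<subseteq> S"
  shows "cograph_on E T"
  using assms
proof (induction arbitrary: T)
  case empty
  then show ?case by (simp add: cograph_on.empty)
next
  case (singleton x)
  then show ?case by (metis cograph_on.empty cograph_on.singleton subset_singletonD)
next
  case (union A B)
  have "cograph_on E (T \<inter> A \<union> T \<inter> B)"
    using union by (intro cograph_on.union) auto
  moreover have "T \<inter> A \<union> T \<inter> B = T" using union.prems by blast
  ultimately show ?case by simp
next
  case (join A B)
  have "cograph_on E (T \<inter> A \<union> T \<inter> B)"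
    using join by (intro cograph_on.join) auto
  moreover have "T \<inter> A \<union> T \<inter> B = T" using join.prems by blast
  ultimately show ?case by simp
qed

lemma cograph_on_co_rel:
  assumes "cograph_on E S"
  shows "cograph_on (co_rel E) S"
  using assms
proof (induction)
  case (union A B)
  then show ?case by (intro cograph_on.join) (auto simp: co_rel_def)
next
  case (join A B)
  then show ?case by (intro cograph_on.union) (auto simp: co_rel_def)
qed (auto intro: cograph_on.intros)

text \<open>Complementation exchanges \<open>union\<close> and \<open>join\<close>. The converse
  needs its own induction, because \<open>co_rel (co_rel E)\<close> agrees with \<open>E\<close>
  only off the diagonal; disjointness of the two parts keeps every compared pair off it.\<close>

lemma cograph_on_co_rel_iff: "cograph_on (co_rel E) S \<longleftrightarrow> cograph_on E S"
proof
  assume "cograph_on (co_rel E) S"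
  then show "cograph_on E S"
  proof (induction)
    case (union A B)
    then show ?case by (intro cograph_on.join) (auto simp: co_rel_def)
  next
    case (join A B)
    then show ?case by (intro cograph_on.union) (auto simp: co_rel_def)
  qed (auto intro: cograph_on.intros)
qed (rule cograph_on_co_rel)

text \<open>Perfection of cographs in certified form: a clique and a colouring with as many colours
  are built together. A union keeps the larger clique and shares the colours; a join merges the
  cliques and shifts the colours of the second part past those of the first.\<close>

lemma cograph_on_clique_coloring:
  assumes "cograph_on E S" "symp E"
  shows "\<exists>K c. finite K \<and> K \<subseteq> S \<and> (\<forall>x\<in>K. \<forall>y\<in>K. x \<noteq> y \<longrightarrow> E x y) \<and>
    (\<forall>x\<in>S. c x < card K) \<and> (\<forall>x\<in>S. \<forall>y\<in>S. x \<noteq> y \<longrightarrow> E x y \<longrightarrow> c x \<noteq> (c y :: nat))"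
  using assms
proof (induction)
  case empty
  then show ?case by auto
next
  case (singleton x)
  show ?case by (rule exI[of _ "{x}"], rule exI[of _ "\<lambda>_. 0"]) auto
next
  case (union A B)
  from union.IH(1)[OF \<open>symp E\<close>] obtain K c where K: "finite K" "K \<subseteq> A" "\<forall>x\<in>K. \<forall>y\<in>K. x \<noteq> y \<longrightarrow> E x y"
    "\<forall>x\<in>A. c x < card K" "\<forall>x\<in>A. \<forall>y\<in>A. x \<noteq> y \<longrightarrow> E x y \<longrightarrow> c x \<noteq> (c y :: nat)"
    by blast
  from union.IH(2)[OF \<open>symp E\<close>] obtain L d where L: "finite L" "L \<subseteq> B" "\<forall>x\<in>L. \<forall>y\<in>L. x \<noteq> y \<longrightarrow> E x y"
    "\<forall>x\<in>B. d x < card L" "\<forall>x\<in>B. \<forall>y\<in>B. x \<noteq> y \<longrightarrow> E x y \<longrightarrow> d x \<noteq> (d y :: nat)"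
    by blast
  define M where "M = (if card K \<le> card L then L else K)"
  have M: "finite M" "M \<subseteq> A \<union> B" "\<forall>x\<in>M. \<forall>y\<in>M. x \<noteq> y \<longrightarrow> E x y"
    "card K \<le> card M" "card L \<le> card M"
    using K L by (auto simp: M_def)
  have no: "\<not> E a b" "\<not> E b a" if "a \<in> A" "b \<in> B" for a b
    using union.hyps(4)[OF that] sympD[OF \<open>symp E\<close>] by blast+
  show ?case
  proof (intro exI conjI)
    show "\<forall>x\<in>A \<union> B. (if x \<in> A then c x else d x) < card M"
      using K(4) L(4) M(4,5) by (auto intro: less_le_trans)
    show "\<forall>x\<in>A \<union> B. \<forall>y\<in>A \<union> B. x \<noteq> y \<longrightarrow> E x y \<longrightarrow>
        (if x \<in> A then c x else d x) \<noteq> (if y \<in> A then c y else d y)"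
    proof (intro ballI impI)
      fix x y assume xy: "x \<in> A \<union> B" "y \<in> A \<union> B" "x \<noteq> y" "E x y"
      have "x \<in> A \<longleftrightarrow> y \<in> A" using xy no by blast
      moreover have "x \<in> A \<Longrightarrow> y \<in> A \<Longrightarrow> c x \<noteq> c y" using K(5) xy(3,4) by blast
      moreover have "x \<notin> A \<Longrightarrow> y \<notin> A \<Longrightarrow> d x \<noteq> d y" using L(5) xy by blast
      ultimately show "(if x \<in> A then c x else d x) \<noteq> (if y \<in> A then c y else d y)"
        by auto
    qed
  qed (use M(1-3) in auto)
next
  case (join A B)
  from join.IH(1)[OF \<open>symp E\<close>] obtain K c where K: "finite K" "K \<subseteq> A" "\<forall>x\<in>K. \<forall>y\<in>K. x \<noteq> y \<longrightarrow> E x y"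
    "\<forall>x\<in>A. c x < card K" "\<forall>x\<in>A. \<forall>y\<in>A. x \<noteq> y \<longrightarrow> E x y \<longrightarrow> c x \<noteq> (c y :: nat)"
    by blast
  from join.IH(2)[OF \<open>symp E\<close>] obtain L d where L: "finite L" "L \<subseteq> B" "\<forall>x\<in>L. \<forall>y\<in>L. x \<noteq> y \<longrightarrow> E x y"
    "\<forall>x\<in>B. d x < card L" "\<forall>x\<in>B. \<forall>y\<in>B. x \<noteq> y \<longrightarrow> E x y \<longrightarrow> d x \<noteq> (d y :: nat)"
    by blast
  have card: "card (K \<union> L) = card K + card L"
    using K L join.hyps(3) by (intro card_Un_disjoint) auto
  have yes: "E a b" "E b a" if "a \<in> A" "b \<in> B" for a b
    using join.hyps(4)[OF that] sympD[OF \<open>symp E\<close>] by blast+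
  show ?case
  proof (intro exI conjI)
    show "\<forall>x\<in>K \<union> L. \<forall>y\<in>K \<union> L. x \<noteq> y \<longrightarrow> E x y"
      using K(2,3) L(2,3) yes by blast
    show "\<forall>x\<in>A \<union> B. (if x \<in> A then c x else card K + d x) < card (K \<union> L)"
      using K(4) L(4) card by auto
    show "\<forall>x\<in>A \<union> B. \<forall>y\<in>A \<union> B. x \<noteq> y \<longrightarrow> E x y \<longrightarrow>
        (if x \<in> A then c x else card K + d x) \<noteq> (if y \<in> A then c y else card K + d y)"
    proof (intro ballI impI)
      fix x y assume xy: "x \<in> A \<union> B" "y \<in> A \<union> B" "x \<noteq> y" "E x y"
      have "x \<in> A \<Longrightarrow> c x < card K" "y \<in> A \<Longrightarrow> c y < card K" using K(4) by auto
      moreover have "x \<in> A \<Longrightarrow> y \<in> A \<Longrightarrow> c x \<noteq> c y" using K(5) xy(3,4) by blast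
      moreover have "x \<notin> A \<Longrightarrow> y \<notin> A \<Longrightarrow> d x \<noteq> d y" using L(5) xy by blast
      ultimately show "(if x \<in> A then c x else card K + d x) \<noteq> (if y \<in> A then c y else card K + d y)"
        by auto
    qed
  qed (use K(1,2) L(1,2) in auto)
qed

section \<open>Partitions into a bounded number of cographs\<close>

definition cograph_colorable :: "('a \<Rightarrow> 'a \<Rightarrow> bool) \<Rightarrow> 'a set \<Rightarrow> nat \<Rightarrow> bool" where
  "cograph_colorable E S k \<longleftrightarrow>
     (\<exists>c. (\<forall>x\<in>S. c x < k) \<and> (\<forall>i<k. cograph_on E {x \<in> S. c x = i}))"

lemma cograph_colorable_co_rel: "cograph_colorable (co_rel E) S k \<longleftrightarrow> cograph_colorable E S k"
  by (simp add: cograph_colorable_def cograph_on_co_rel_iff)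

lemma cograph_colorable_empty: "cograph_colorable E {} k"
  by (simp add: cograph_colorable_def cograph_on.empty)

lemma cograph_colorable_singleton: "cograph_colorable E {x} 1"
  unfolding cograph_colorable_def
  by (rule exI[of _ "\<lambda>_. 0"]) (simp add: cograph_on.singleton)

lemma cograph_colorable_subset:
  assumes "cograph_colorable E S k" "T \<subseteq> S"
  shows "cograph_colorable E T k"
proof -
  obtain c where c: "\<forall>x\<in>S. c x < k" "\<forall>i<k. cograph_on E {x \<in> S. c x = i}"
    using assms(1) by (auto simp: cograph_colorable_def)
  have "cograph_on E {x \<in> T. c x = i}" if "i < k" for i
    by (rule cograph_on_subset[of E "{x \<in> S. c x = i}"]) (use c that assms(2) in auto)
  then show ?thesis
    using c(1) assms(2) by (auto simp: cograph_colorable_def)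
qed

lemma cograph_colorable_Un:
  assumes "cograph_colorable E S k" "cograph_colorable E T l"
  shows "cograph_colorable E (S \<union> T) (k + l)"
proof -
  obtain c where c: "\<forall>x\<in>S. c x < k" "\<forall>i<k. cograph_on E {x \<in> S. c x = i}"
    using assms(1) by (auto simp: cograph_colorable_def)
  obtain d where d: "\<forall>x\<in>T. d x < l" "\<forall>i<l. cograph_on E {x \<in> T. d x = i}"
    using assms(2) by (auto simp: cograph_colorable_def)
  \<comment> \<open>Vertices in the overlap keep their colour from \<open>S\<close>, so a class
    coming from \<open>T\<close> may shrink; cographs are hereditary, hence it stays a
    cograph.\<close>
  let ?e = "\<lambda>x. if x \<in> S then c x else k + d x"
  have "cograph_on E {x \<in> S \<union> T. ?e x = i}" if i: "i < k + l" for i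
  proof (cases "i < k")
    case True
    then have "cograph_on E {x \<in> S. c x = i}"
      using c(2) by simp
    then show ?thesis
      by (rule cograph_on_subset) (use True in \<open>auto split: if_splits\<close>)
  next
    case False
    then have "cograph_on E {x \<in> T. d x = i - k}"
      using d(2) i by simp
    then show ?thesis
      by (rule cograph_on_subset) (use c(1) False in \<open>auto split: if_splits\<close>)
  qed
  moreover have "\<forall>x\<in>S \<union> T. ?e x < k + l"
    using c(1) d(1) by auto
  ultimately show ?thesis
    unfolding cograph_colorable_def by (intro exI[of _ ?e] conjI) blast+
qed

text \<open>Colours are shared, since each merged class is a disjoint union of two anticomplete
  cographs. The number of cographs does not grow, which is what lets a large set be replaced by one
  of its components.\<close>

lemma cograph_colorable_anticomplete_Un:
  assumes "cograph_colorable E A k" "cograph_colorable E B k"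
    and "A \<inter> B = {}" "\<And>a b. a \<in> A \<Longrightarrow> b \<in> B \<Longrightarrow> \<not> E a b"
  shows "cograph_colorable E (A \<union> B) k"
proof -
  obtain c where c: "\<forall>x\<in>A. c x < k" "\<forall>i<k. cograph_on E {x \<in> A. c x = i}"
    using assms(1) by (auto simp: cograph_colorable_def)
  obtain d where d: "\<forall>x\<in>B. d x < k" "\<forall>i<k. cograph_on E {x \<in> B. d x = i}"
    using assms(2) by (auto simp: cograph_colorable_def)
  let ?e = "\<lambda>x. if x \<in> A then c x else d x"
  have "cograph_on E {x \<in> A \<union> B. ?e x = i}" if i: "i < k" for i
  proof -
    have "cograph_on E ({x \<in> A. c x = i} \<union> {x \<in> B. d x = i})"
      using c(2) d(2) i assms(3,4) by (intro cograph_on.union) auto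
    moreover have "{x \<in> A. c x = i} \<union> {x \<in> B. d x = i} = {x \<in> A \<union> B. ?e x = i}"
      using assms(3) by auto
    ultimately show ?thesis by simp
  qed
  moreover have "\<forall>x\<in>A \<union> B. ?e x < k"
    using c(1) d(1) by auto
  ultimately show ?thesis
    unfolding cograph_colorable_def by (intro exI[of _ ?e] conjI) blast+
qed

text \<open>Each of the \<open>k\<close> cographs is coloured optimally from a palette of its own
  with \<open>w\<close> colours, where \<open>w\<close> bounds the size of all cliques.\<close>

lemma cograph_colorable_imp_coloring:
  assumes "cograph_colorable E S k" "symp E" "irreflp E"
    and w: "\<And>K. finite K \<Longrightarrow> K \<subseteq> S \<Longrightarrow> \<forall>x\<in>K. \<forall>y\<in>K. x \<noteq> y \<longrightarrow> E x y \<Longrightarrow> card K \<le> w"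
  shows "\<exists>c :: 'a \<Rightarrow> nat. c ` S \<subseteq> {..<k * w} \<and> (\<forall>x\<in>S. \<forall>y\<in>S. E x y \<longrightarrow> c x \<noteq> c y)"
proof -
  obtain p where p: "\<forall>x\<in>S. p x < k" "\<forall>i<k. cograph_on E {x \<in> S. p x = i}"
    using assms(1) by (auto simp: cograph_colorable_def)
  have "\<exists>c. (\<forall>x\<in>S. p x = i \<longrightarrow> c x < w) \<and>
      (\<forall>x\<in>S. \<forall>y\<in>S. p x = i \<longrightarrow> p y = i \<longrightarrow> x \<noteq> y \<longrightarrow> E x y \<longrightarrow> c x \<noteq> (c y :: nat))"
    if "i < k" for i
  proof -
    have "cograph_on E {x \<in> S. p x = i}" using p(2) that by simp
    from cograph_on_clique_coloring[OF this \<open>symp E\<close>]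
    obtain K c where K: "finite K" "K \<subseteq> {x \<in> S. p x = i}" "\<forall>x\<in>K. \<forall>y\<in>K. x \<noteq> y \<longrightarrow> E x y"
      "\<forall>x\<in>{x \<in> S. p x = i}. c x < card K"
      "\<forall>x\<in>{x \<in> S. p x = i}. \<forall>y\<in>{x \<in> S. p x = i}. x \<noteq> y \<longrightarrow> E x y \<longrightarrow> c x \<noteq> (c y :: nat)"
      by blast
    have "card K \<le> w" using w K(1-3) by blast
    then show ?thesis using K(4,5) by (intro exI[of _ c]) auto
  qed
  then obtain c where c: "\<And>i x. i < k \<Longrightarrow> x \<in> S \<Longrightarrow> p x = i \<Longrightarrow> c i x < w"
    "\<And>i x y. i < k \<Longrightarrow> x \<in> S \<Longrightarrow> y \<in> S \<Longrightarrow> p x = i \<Longrightarrow> p y = i \<Longrightarrow> x \<noteq> y \<Longrightarrow> E x y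
      \<Longrightarrow> c i x \<noteq> (c i y :: nat)"
    by metis
  \<comment> \<open>The pair of the index of the cograph and the colour inside it, written in base
    \<open>w\<close>; division by \<open>w\<close> recovers the index.\<close>
  let ?d = "\<lambda>x. p x * w + c (p x) x"
  have "?d x < k * w" if "x \<in> S" for x
  proof -
    have "?d x < Suc (p x) * w" using c(1) p(1) that by simp
    also have "\<dots> \<le> k * w" using p(1) that by (intro mult_right_mono) auto
    finally show ?thesis .
  qed
  moreover have "?d x \<noteq> ?d y" if xy: "x \<in> S" "y \<in> S" "E x y" for x y
  proof
    assume eq: "?d x = ?d y"
    have lt: "c (p x) x < w" "c (p y) y < w" using c(1) p(1) xy by auto
    have "?d x div w = p x" "?d y div w = p y" using lt by auto
    then have "p x = p y" using eq by simp
    moreover have "x \<noteq> y" using xy(3) \<open>irreflp E\<close> by (auto simp: irreflp_def)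
    moreover have "c (p x) x = c (p x) y" using eq \<open>p x = p y\<close> by simp
    ultimately show False using c(2)[of "p x" x y] p(1) xy by metis
  qed
  ultimately have "?d ` S \<subseteq> {..<k * w} \<and> (\<forall>x\<in>S. \<forall>y\<in>S. E x y \<longrightarrow> ?d x \<noteq> ?d y)"
    by blast
  then show ?thesis by (rule exI[of _ ?d])
qed

section \<open>Connectivity and Gyarfas' path argument\<close>

text \<open>Connectivity is expressed by cuts instead of walks: a failure directly gives an
  anticomplete splitting, and a proper part directly gives an edge that leaves it.\<close>

definition connected_on :: "('a \<Rightarrow> 'a \<Rightarrow> bool) \<Rightarrow> 'a set \<Rightarrow> bool" where
  "connected_on E C \<longleftrightarrow> C \<noteq> {} \<and>
     (\<forall>A \<subseteq> C. A \<noteq> {} \<longrightarrow> A \<noteq> C \<longrightarrow> (\<exists>a\<in>A. \<exists>b\<in>C - A. E a b))"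

text \<open>If \<open>M\<close> has a cut without edges, then by
  \<open>cograph_colorable_anticomplete_Un\<close> one side is still not colourable with
  \<open>k\<close> cographs; the induction continues in that side.\<close>

lemma exists_component_not_cograph_colorable:
  assumes "finite M" "symp E" "\<not> cograph_colorable E M k"
  shows "\<exists>D \<subseteq> M. connected_on E D \<and> (\<forall>x\<in>D. \<forall>y\<in>M - D. \<not> E x y) \<and> \<not> cograph_colorable E D k"
  using assms(1,3)
proof (induction M rule: finite_psubset_induct)
  case (psubset M)
  show ?case
  proof (cases "connected_on E M")
    case True
    then show ?thesis using psubset.prems by (intro exI[of _ M]) auto
  next
    case False
    have "M \<noteq> {}" using psubset.prems cograph_colorable_empty by metis
    then obtain A where A: "A \<subseteq> M" "A \<noteq> {}" "A \<noteq> M" "\<And>a b. a \<in> A \<Longrightarrow> b \<in> M - A \<Longrightarrow> \<not> E a b"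
      using False by (auto simp: connected_on_def)
    have sym: "\<not> E b a" if "a \<in> A" "b \<in> M - A" for a b
      using A(4)[OF that] sympD[OF \<open>symp E\<close>] by blast
    have "A \<union> (M - A) = M" using A(1) by blast
    then have "\<not> cograph_colorable E A k \<or> \<not> cograph_colorable E (M - A) k"
      using cograph_colorable_anticomplete_Un[of E A k "M - A", OF _ _ _ A(4)] psubset.prems by auto
    then obtain B where B: "B = A \<or> B = M - A" "\<not> cograph_colorable E B k" by blast
    have "B \<subset> M" using B(1) A by blast
    then obtain D where D: "D \<subseteq> B" "connected_on E D" "\<forall>x\<in>D. \<forall>y\<in>B - D. \<not> E x y"
      "\<not> cograph_colorable E D k"
      using psubset.IH[OF _ B(2)] by blast
    have "\<not> E x y" if "x \<in> D" "y \<in> M - D" for x y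
      using that D(1,3) B(1) A(4) sym by blast
    moreover have "D \<subseteq> M" using D(1) \<open>B \<subset> M\<close> by blast
    ultimately show ?thesis using D(2,4) by blast
  qed
qed

text \<open>A large component \<open>D\<close> of \<open>C - U\<close> has no edge to the rest of
  \<open>C - U\<close>, so the edge leaving \<open>D\<close> that exists by connectivity of
  \<open>C\<close> must end in \<open>U\<close>.\<close>

lemma connected_on_remove:
  assumes "finite C" "symp E" "connected_on E C" "U \<subseteq> C" "U \<noteq> {}"
    and "\<not> cograph_colorable E (C - U) k"
  shows "\<exists>u\<in>U. \<exists>D \<subseteq> C - U. connected_on E D \<and> \<not> cograph_colorable E D k \<and> (\<exists>x\<in>D. E u x)"
proof -
  obtain D where D: "D \<subseteq> C - U" "connected_on E D" "\<forall>x\<in>D. \<forall>y\<in>C - U - D. \<not> E x y"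
    "\<not> cograph_colorable E D k"
    using exists_component_not_cograph_colorable[OF finite_Diff[OF assms(1)] assms(2,6)] by blast
  have "D \<subseteq> C" "D \<noteq> {}" "D \<noteq> C" using D(1,2) assms(4,5) by (auto simp: connected_on_def)
  then obtain a b where "a \<in> D" "b \<in> C - D" "E a b"
    using assms(3) unfolding connected_on_def by blast
  then have "b \<in> U" "E b a" using D(3) sympD[OF \<open>symp E\<close>] by blast+
  then show ?thesis using D \<open>a \<in> D\<close> by blast
qed

fun induced_path :: "('a \<Rightarrow> 'a \<Rightarrow> bool) \<Rightarrow> 'a list \<Rightarrow> bool" where
  "induced_path E [] = True"
| "induced_path E [x] = True"
| "induced_path E (x # y # zs) \<longleftrightarrow>
     x \<noteq> y \<and> x \<notin> set zs \<and> E x y \<and> (\<forall>z\<in>set zs. \<not> E x z) \<and> induced_path E (y # zs)"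

text \<open>Deleting the neighbours of \<open>v\<close> in \<open>C\<close> costs at most
  \<open>K\<close> cographs. A large component of the rest is attached to one of these neighbours,
  from which the path goes on. All later vertices are non-neighbours of \<open>v\<close>, so the
  path is induced.\<close>

lemma gyarfas_path_from:
  assumes "finite S" "symp E"
    and small: "\<And>w Y. w \<in> S \<Longrightarrow> Y \<subseteq> S \<Longrightarrow> (\<And>y. y \<in> Y \<Longrightarrow> E w y) \<Longrightarrow> cograph_colorable E Y K"
    and "v \<in> S" "C \<subseteq> S" "v \<notin> C" "connected_on E C" "\<exists>x\<in>C. E v x"
    and "\<not> cograph_colorable E C (m * K)"
  shows "\<exists>xs. induced_path E (v # xs) \<and> set xs \<subseteq> C \<and> length xs = m"
  using assms(4-)
proof (induction m arbitrary: v C)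
  case 0
  then show ?case by auto
next
  case (Suc m)
  define U where "U = {x \<in> C. E v x}"
  have U: "U \<subseteq> C" "U \<noteq> {}" using Suc.prems by (auto simp: U_def)
  have col: "cograph_colorable E U K"
  proof (rule small)
    show "v \<in> S" "U \<subseteq> S" using Suc.prems(1,2) U(1) by blast+
  qed (simp add: U_def)
  have "U \<union> (C - U) = C" using U(1) by blast
  then have "\<not> cograph_colorable E (C - U) (m * K)"
    using Suc.prems(6) cograph_colorable_Un[OF col, of "C - U" "m * K"] by (metis mult_Suc)
  from connected_on_remove[OF finite_subset[OF Suc.prems(2) \<open>finite S\<close>] \<open>symp E\<close> Suc.prems(4) U this]
  obtain u D where D: "u \<in> U" "D \<subseteq> C - U" "connected_on E D"
    "\<not> cograph_colorable E D (m * K)" "\<exists>x\<in>D. E u x"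
    by blast
  have "u \<in> S" "D \<subseteq> S" "u \<notin> D" using D(1,2) U(1) Suc.prems(2) by auto
  then obtain xs where xs: "induced_path E (u # xs)" "set xs \<subseteq> D" "length xs = m"
    using Suc.IH[of u D] D by blast
  have "E v u" "v \<noteq> u" using D(1) Suc.prems(3) U(1) by (auto simp: U_def)
  moreover have "\<forall>z\<in>set xs. \<not> E v z" "v \<notin> set xs"
    using xs(2) D(2) Suc.prems(3) by (auto simp: U_def)
  ultimately have "induced_path E (v # u # xs)" using xs(1) by simp
  then show ?case using xs D U(1) by (intro exI[of _ "u # xs"]) auto
qed

lemma gyarfas_path:
  assumes "finite S" "symp E"
    and small: "\<And>w Y. w \<in> S \<Longrightarrow> Y \<subseteq> S \<Longrightarrow> (\<And>y. y \<in> Y \<Longrightarrow> E w y) \<Longrightarrow> cograph_colorable E Y K"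
    and "\<not> cograph_colorable E S (m * K + 1)"
  shows "\<exists>xs. induced_path E xs \<and> set xs \<subseteq> S \<and> length xs = m"
proof -
  obtain C where C: "C \<subseteq> S" "connected_on E C" "\<not> cograph_colorable E C (m * K + 1)"
    using exists_component_not_cograph_colorable[OF assms(1,2,4)] by blast
  then obtain v where v: "v \<in> C" by (auto simp: connected_on_def)
  \<comment> \<open>The extra 1 in the bound pays for the start vertex \<open>v\<close>.\<close>
  have "\<not> cograph_colorable E (C - {v}) (m * K)"
    using C(3) cograph_colorable_Un[OF _ cograph_colorable_singleton, of E "C - {v}" "m * K" v] v
    by (auto simp: insert_absorb)
  then obtain D where D: "D \<subseteq> C - {v}" "connected_on E D" "\<not> cograph_colorable E D (m * K)"
    "\<exists>x\<in>D. E v x"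
    using connected_on_remove[OF finite_subset[OF C(1) \<open>finite S\<close>] \<open>symp E\<close> C(2), of "{v}" "m * K"] v
    by blast
  have "\<exists>xs. induced_path E (v # xs) \<and> set xs \<subseteq> D \<and> length xs = m"
  proof (rule gyarfas_path_from[OF assms(1,2)])
    show "cograph_colorable E Y K" if "w \<in> S" "Y \<subseteq> S" "\<And>y. y \<in> Y \<Longrightarrow> E w y" for w Y
      using small that by blast
    show "v \<in> S" "D \<subseteq> S" "v \<notin> D" using C(1) D(1) v by blast+
  qed (fact D)+
  then obtain xs where xs: "induced_path E (v # xs)" "set xs \<subseteq> D" "length xs = m" by blast
  \<comment> \<open>With \<open>v\<close> the path has \<open>m + 1\<close> vertices; dropping
    \<open>v\<close> leaves exactly \<open>m\<close>.\<close>
  have "induced_path E xs" using xs(1) by (cases xs) auto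
  then show ?thesis using xs(2,3) D(1) C(1) by blast
qed

section \<open>Splitting a large set at a vertex\<close>

text \<open>The bound is \<open>m * K + 1\<close> for the neighbours of a vertex \<open>v\<close>,
  the same for its non-neighbours, and 1 for \<open>v\<close>. In the third outcome \<open>v\<close>
  serves as \<open>b\<close> if the non-neighbours are large and as \<open>a\<close> if the
  neighbours are. That \<open>b\<close> lies outside \<open>X\<close> is recorded since
  non-adjacency does not imply it.\<close>

lemma path_or_copath_or_split:
  assumes "finite S" "symp E"
    and S: "\<not> cograph_colorable E S (2 * (m * K + 1) + 1)"
  obtains xs where "induced_path E xs" "set xs \<subseteq> S" "length xs = m"
  | v xs where "v \<in> S" "\<forall>x\<in>set xs. E v x" "induced_path (co_rel E) xs" "set xs \<subseteq> S" "length xs = m"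
  | a b X where "a \<in> S" "b \<in> S" "X \<subseteq> S" "b \<notin> X" "\<forall>x\<in>X. E a x" "\<forall>x\<in>X. \<not> E b x"
      "\<not> cograph_colorable E X K"
proof -
  have "S \<noteq> {}" using S cograph_colorable_empty by metis
  then obtain v where v: "v \<in> S" by blast
  define N where "N = {x \<in> S. E v x}"
  define M where "M = {x \<in> S. x \<noteq> v \<and> \<not> E v x}"
  have "S = N \<union> M \<union> {v}" using v by (auto simp: N_def M_def)
  then have "\<not> cograph_colorable E N (m * K + 1) \<or> \<not> cograph_colorable E M (m * K + 1)"
    using S cograph_colorable_Un[OF cograph_colorable_Un[of E N "m * K + 1" M "m * K + 1"]
        cograph_colorable_singleton[of E v]]
    by (metis mult_2)
  then show ?thesis
  proof
    assume M: "\<not> cograph_colorable E M (m * K + 1)"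
    show ?thesis
    proof (cases "\<exists>w\<in>M. \<exists>Y \<subseteq> M. (\<forall>y\<in>Y. E w y) \<and> \<not> cograph_colorable E Y K")
      case True
      then obtain w Y where wY: "w \<in> M" "Y \<subseteq> M" "\<forall>y\<in>Y. E w y" "\<not> cograph_colorable E Y K"
        by blast
      have "w \<in> S" "Y \<subseteq> S" "v \<notin> Y" "\<forall>x\<in>Y. \<not> E v x" using wY(1,2) by (auto simp: M_def)
      then show ?thesis by (intro that(3)[of w v Y] v wY(3,4))
    next
      case False
      have "finite M" using \<open>finite S\<close> by (simp add: M_def)
      then have "\<exists>xs. induced_path E xs \<and> set xs \<subseteq> M \<and> length xs = m"
      proof (rule gyarfas_path[OF _ assms(2) _ M])
        show "cograph_colorable E Y K"
          if "w \<in> M" "Y \<subseteq> M" "\<And>y. y \<in> Y \<Longrightarrow> E w y" for w Y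
          using False that by blast
      qed
      then obtain xs where xs: "induced_path E xs" "set xs \<subseteq> M" "length xs = m" by blast
      have "set xs \<subseteq> S" using xs(2) by (auto simp: M_def)
      then show ?thesis by (intro that(1)[of xs] xs(1,3))
    qed
  next
    assume N: "\<not> cograph_colorable E N (m * K + 1)"
    show ?thesis
    proof (cases "\<exists>w\<in>N. \<exists>Y \<subseteq> N. (\<forall>y\<in>Y. co_rel E w y) \<and> \<not> cograph_colorable E Y K")
      case True
      then obtain w Y where wY: "w \<in> N" "Y \<subseteq> N" "\<forall>y\<in>Y. co_rel E w y" "\<not> cograph_colorable E Y K"
        by blast
      have "w \<in> S" "Y \<subseteq> S" "w \<notin> Y" "\<forall>x\<in>Y. E v x" "\<forall>x\<in>Y. \<not> E w x"
        using wY(1-3) by (auto simp: N_def co_rel_def)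
      then show ?thesis by (intro that(3)[of v w Y] v wY(4))
    next
      case False
      have "finite N" using \<open>finite S\<close> by (simp add: N_def)
      \<comment> \<open>The path argument runs in the complement, where \<open>N\<close> is still
        large because partitions into cographs are invariant under complementation.\<close>
      then have "\<exists>xs. induced_path (co_rel E) xs \<and> set xs \<subseteq> N \<and> length xs = m"
      proof (rule gyarfas_path[OF _ symp_co_rel[OF assms(2)]])
        show "cograph_colorable (co_rel E) Y K"
          if "w \<in> N" "Y \<subseteq> N" "\<And>y. y \<in> Y \<Longrightarrow> co_rel E w y" for w Y
          using False that unfolding cograph_colorable_co_rel by blast
        show "\<not> cograph_colorable (co_rel E) N (m * K + 1)"
          using N unfolding cograph_colorable_co_rel .
      qed
      then obtain xs where xs: "induced_path (co_rel E) xs" "set xs \<subseteq> N" "length xs = m" by blast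
      have "set xs \<subseteq> S" "\<forall>x\<in>set xs. E v x" using xs(2) by (auto simp: N_def)
      then show ?thesis by (intro that(2)[of v xs] v xs(1,3))
    qed
  qed
qed

section \<open>Alternating sequences in large sets\<close>

text \<open>For symmetric \<open>E\<close> these are orderings of threshold graphs in which vertices
  complete and anticomplete to their successors alternate; \<open>b\<close> is the type of the first
  one.\<close>

fun alternating :: "('a \<Rightarrow> 'a \<Rightarrow> bool) \<Rightarrow> bool \<Rightarrow> 'a list \<Rightarrow> bool" where
  "alternating E b [] = True"
| "alternating E b (x # xs) \<longleftrightarrow>
     x \<notin> set xs \<and> (\<forall>y\<in>set xs. E x y = b) \<and> alternating E (\<not> b) xs"

text \<open>This is applied to local complementation at a vertex complete to all later ones, which
  complements the relation among those.\<close>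

lemma alternating_complement:
  assumes "alternating E b xs" "\<And>x y. x \<in> set xs \<Longrightarrow> y \<in> set xs \<Longrightarrow> x \<noteq> y \<Longrightarrow> E' x y = (\<not> E x y)"
  shows "alternating E' (\<not> b) xs"
  using assms
proof (induction xs arbitrary: b)
  case (Cons x xs)
  have "alternating E' (\<not> (\<not> b)) xs" using Cons.prems by (intro Cons.IH) auto
  moreover have "E' x y = (\<not> b)" if "y \<in> set xs" for y
    using Cons.prems(1) Cons.prems(2)[of x y] that by auto
  ultimately show ?case using Cons.prems(1) by auto
qed simp

text \<open>The recursion is the bound of \<open>path_or_copath_or_split\<close> with
  \<open>K = split_bound m n\<close>, so the set \<open>X\<close> obtained there is still too large
  for \<open>split_bound m n\<close> cographs.\<close>

fun split_bound :: "nat \<Rightarrow> nat \<Rightarrow> nat" where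
  "split_bound m 0 = 0"
| "split_bound m (Suc n) = 2 * (m * split_bound m n + 1) + 1"

text \<open>Every split supplies vertices of both types over the same set \<open>X\<close>, so the
  type required by \<open>b\<close> can be chosen as the next vertex. The induction on
  \<open>n\<close> generalises \<open>b\<close>, which flips on passing to \<open>X\<close>.\<close>

lemma path_or_copath_or_alternating:
  assumes "finite S" "symp E" "irreflp E" "\<not> cograph_colorable E S (split_bound m n)"
  obtains xs where "induced_path E xs" "set xs \<subseteq> S" "length xs = m"
  | v xs where "v \<in> S" "\<forall>x\<in>set xs. E v x" "induced_path (co_rel E) xs" "set xs \<subseteq> S" "length xs = m"
  | xs where "alternating E b xs" "set xs \<subseteq> S" "length xs = n"
  using assms(1,4)
proof (induction n arbitrary: S b thesis)
  case 0
  show ?case by (rule "0.prems"(3)[of "[]"]) auto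
next
  case (Suc n)
  have "\<not> cograph_colorable E S (2 * (m * split_bound m n + 1) + 1)"
    using Suc.prems(5) by simp
  from path_or_copath_or_split[OF Suc.prems(4) assms(2) this]
  show ?case
  proof cases
    case 1
    then show ?thesis using Suc.prems(1) by blast
  next
    case 2
    then show ?thesis using Suc.prems(2) by blast
  next
    case (3 a c X)
    have "finite X" using 3(3) Suc.prems(4) finite_subset by blast
    show ?thesis
    proof (rule Suc.IH[OF _ _ _ \<open>finite X\<close> 3(7), where b = "\<not> b"])
      fix xs assume "induced_path E xs" "set xs \<subseteq> X" "length xs = m"
      then show ?thesis using Suc.prems(1) 3(3) by blast
    next
      fix v xs
      assume "v \<in> X" "\<forall>x\<in>set xs. E v x" "induced_path (co_rel E) xs" "set xs \<subseteq> X" "length xs = m"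
      then show ?thesis using Suc.prems(2) 3(3) by blast
    next
      fix xs assume xs: "alternating E (\<not> b) xs" "set xs \<subseteq> X" "length xs = n"
      define u where "u = (if b then a else c)"
      have "a \<notin> X" using 3(5) \<open>irreflp E\<close> by (auto simp: irreflp_def)
      then have "alternating E b (u # xs)"
        using xs 3(4-6) by (cases b) (auto simp: u_def)
      moreover have "set (u # xs) \<subseteq> S" using xs(2) 3(1-3) by (auto simp: u_def)
      ultimately show ?thesis using Suc.prems(3)[of "u # xs"] xs(3) by simp
    qed
  qed
qed

section \<open>Local complementation on adjacency relations\<close>

definition local_complement_rel :: "('a \<Rightarrow> 'a \<Rightarrow> bool) \<Rightarrow> 'a \<Rightarrow> 'a \<Rightarrow> 'a \<Rightarrow> bool" where
  "local_complement_rel E v x y \<longleftrightarrow> (if x \<noteq> y \<and> E v x \<and> E v y then \<not> E x y else E x y)"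

lemma symp_local_complement_rel: "symp E \<Longrightarrow> symp (local_complement_rel E v)"
  by (auto simp: symp_def local_complement_rel_def)

lemma irreflp_local_complement_rel: "irreflp E \<Longrightarrow> irreflp (local_complement_rel E v)"
  by (auto simp: irreflp_def local_complement_rel_def)

lemma induced_path_cong:
  assumes "induced_path E xs" "\<And>x y. x \<in> set xs \<Longrightarrow> y \<in> set xs \<Longrightarrow> x \<noteq> y \<Longrightarrow> E' x y = E x y"
  shows "induced_path E' xs"
  using assms
proof (induction E xs rule: induced_path.induct)
  case (3 E x y zs)
  have "induced_path E' (y # zs)" using 3 by auto
  then show ?case using 3(2) 3(3)[of x] by auto
qed auto

text \<open>All vertices of \<open>xs\<close> are neighbours of \<open>v\<close>, so the relation
  among them turns into its complement.\<close>

lemma copath_local_complement_rel: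
  assumes "induced_path (co_rel E) xs" "\<forall>x\<in>set xs. E v x"
  shows "induced_path (local_complement_rel E v) xs"
  by (rule induced_path_cong[OF assms(1)]) (use assms(2) in \<open>auto simp: local_complement_rel_def co_rel_def\<close>)

text \<open>The path built so far is \<open>ps\<close>, newest vertex first. Its head is complete to the remaining vertices
  \<open>xs\<close>, so local complementation at the first vertex of \<open>xs\<close> detaches the head from the others, and it
  also complements the rest of \<open>xs\<close>, whose first vertex becomes complete to its successors.\<close>

lemma alternating_foldl_local_complement_rel:
  assumes "symp E" "irreflp E" "alternating E True xs" "induced_path E ps" "set ps \<inter> set xs = {}"
    and "ps \<noteq> [] \<Longrightarrow> \<forall>x\<in>set xs. E (hd ps) x"
    and "\<forall>p\<in>set (tl ps). \<forall>x\<in>set xs. \<not> E p x"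
  shows "induced_path (foldl local_complement_rel E xs) (rev xs @ ps)"
  using assms
proof (induction xs arbitrary: E ps)
  case (Cons x xs)
  have irr: "\<not> E x x" using Cons.prems(2) by (auto simp: irreflp_def)
  have sym: "E u w = E w u" for u w using Cons.prems(1) by (auto simp: symp_def)
  have x: "\<forall>y\<in>set xs. E x y" "x \<notin> set xs" "alternating E False xs" using Cons.prems(3) by auto
  have tl: "\<forall>p\<in>set (tl ps). \<not> E x p" using Cons.prems(7) sym by auto
  have hd: "ps \<noteq> [] \<Longrightarrow> E x (hd ps)" using Cons.prems(6) sym by auto
  have alt: "alternating (local_complement_rel E x) True xs"
    using alternating_complement[OF x(3), of "local_complement_rel E x"] x(1) by (auto simp: local_complement_rel_def)
  have ps: "induced_path (local_complement_rel E x) (x # ps)"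
  proof -
    have "induced_path E (x # ps)"
      using Cons.prems(4,5) hd tl by (cases ps) auto
    \<comment> \<open>A pair changes only if both members are neighbours of \<open>x\<close>, and
      among \<open>x # ps\<close> the only possible neighbour is the head of
      \<open>ps\<close>.\<close>
    moreover have "local_complement_rel E x u w = E u w"
      if "u \<in> set (x # ps)" "w \<in> set (x # ps)" "u \<noteq> w" for u w
      using that tl irr by (cases ps) (auto simp: local_complement_rel_def)
    ultimately show ?thesis by (rule induced_path_cong)
  qed
  have "induced_path (foldl local_complement_rel (local_complement_rel E x) xs) (rev xs @ x # ps)"
  proof (rule Cons.IH[OF symp_local_complement_rel[OF Cons.prems(1)]
        irreflp_local_complement_rel[OF Cons.prems(2)] alt ps])
    show "set (x # ps) \<inter> set xs = {}" using Cons.prems(5) x(2) by auto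
    show "\<forall>y\<in>set xs. local_complement_rel E x (hd (x # ps)) y" using x(1) irr by (auto simp: local_complement_rel_def)
    show "\<forall>p\<in>set (tl (x # ps)). \<forall>y\<in>set xs. \<not> local_complement_rel E x p y"
      using hd tl x(1) Cons.prems(5-7) by (cases ps) (auto simp: local_complement_rel_def)
  qed
  then show ?case by simp
qed simp

section \<open>Translation to graphs and vertex-minors\<close>

lemma adjacent_sym: "adjacent G x y \<longleftrightarrow> adjacent G y x"
  by (simp add: adjacent_def insert_commute)

lemma symp_adjacent: "symp (adjacent G)"
  by (auto simp: symp_def adjacent_sym)

lemma irreflp_adjacent: "fin_simple_graph G \<Longrightarrow> irreflp (adjacent G)"
  by (auto simp: irreflp_def adjacent_def fin_simple_graph_def)

lemma adjacent_local_complement: "adjacent (local_complement G v) = local_complement_rel (adjacent G) v"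
proof (intro ext)
  fix x y
  have "{x, y} \<in> {{x, y} | x y. x \<in> neighborhood G v \<and> y \<in> neighborhood G v \<and> x \<noteq> y}
      \<longleftrightarrow> x \<noteq> y \<and> adjacent G v x \<and> adjacent G v y"
    by (auto simp: neighborhood_def doubleton_eq_iff)
  then show "adjacent (local_complement G v) x y = local_complement_rel (adjacent G) v x y"
    unfolding adjacent_def[of "local_complement G v"] local_complement_def local_complement_rel_def
    by (auto simp: adjacent_def)
qed

lemma verts_foldl_local_complement: "verts (foldl local_complement G xs) = verts G"
  by (induction xs arbitrary: G) (auto simp: local_complement_def)

lemma adjacent_foldl_local_complement:
  "adjacent (foldl local_complement G xs) = foldl local_complement_rel (adjacent G) xs"
  by (induction xs arbitrary: G) (auto simp: adjacent_local_complement)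

lemma locally_equivalent_foldl:
  "set xs \<subseteq> verts G \<Longrightarrow> locally_equivalent G (foldl local_complement G xs)"
proof (induction xs rule: rev_induct)
  case (snoc x xs)
  then show ?case by (auto intro!: locally_equivalent.step simp: verts_foldl_local_complement)
qed (simp add: locally_equivalent.refl)

lemma induced_path_distinct: "induced_path E xs \<Longrightarrow> distinct xs"
  by (induction E xs rule: induced_path.induct) auto

lemma induced_path_nth:
  assumes "induced_path E xs" "i < j" "j < length xs"
  shows "E (xs ! i) (xs ! j) \<longleftrightarrow> j = Suc i"
  using assms
proof (induction E xs arbitrary: i j rule: induced_path.induct)
  case (3 E x y zs)
  show ?case
  proof (cases i)
    case 0
    then show ?thesis using 3(2-4) by (cases j; cases "j - 1") (auto simp: nth_Cons')
  next
    case (Suc i')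
    then show ?thesis using 3(1)[of i' "j - 1"] 3(2-4) by (cases j) auto
  qed
qed auto

lemma adjacent_path_graph:
  "adjacent (path_graph t) i j \<longleftrightarrow> i < t \<and> j < t \<and> (j = Suc i \<or> i = Suc j)"
  by (auto simp: adjacent_def path_graph_def doubleton_eq_iff)

lemma adjacent_induce: "x \<in> S \<Longrightarrow> y \<in> S \<Longrightarrow> adjacent (induce G S) x y = adjacent G x y"
  by (auto simp: adjacent_def induce_def)

lemma vertex_minor_path_graph:
  assumes "fin_simple_graph G" "set vs \<subseteq> verts G" "set xs \<subseteq> verts G"
    and path: "induced_path (foldl local_complement_rel (adjacent G) vs) xs"
  shows "\<exists>H. vertex_minor H G \<and> graph_iso H (path_graph (length xs))"
proof -
  define G' where "G' = foldl local_complement G vs"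
  define H where "H = induce G' (set xs)"
  \<comment> \<open>The isomorphism sends each vertex to its position on the path.\<close>
  define \<phi> where "\<phi> = the_inv_into {..<length xs} (nth xs)"
  have "locally_equivalent G G'" "set xs \<subseteq> verts G'"
    using locally_equivalent_foldl[OF assms(2)] assms(3)
    by (simp_all add: G'_def verts_foldl_local_complement)
  then have "vertex_minor H G"
    unfolding vertex_minor_def induced_subgraph_def H_def by blast
  moreover have "graph_iso H (path_graph (length xs))"
    unfolding graph_iso_def
  proof (intro exI conjI ballI)
    have dist: "distinct xs" using induced_path_distinct[OF path] .
    have bij: "bij_betw (nth xs) {..<length xs} (set xs)"
      by (rule bij_betw_nth[OF dist]) auto
    show "bij_betw \<phi> (verts H) (verts (path_graph (length xs)))"
      unfolding \<phi>_def using bij_betw_the_inv_into[OF bij]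
      by (simp add: H_def induce_def path_graph_def)
    fix x y assume "x \<in> verts H" "y \<in> verts H"
    then have xy: "x \<in> set xs" "y \<in> set xs" by (auto simp: H_def induce_def)
    then obtain i j where ij: "i < length xs" "x = xs ! i" "j < length xs" "y = xs ! j"
      by (metis in_set_conv_nth)
    have \<phi>: "\<phi> x = i" "\<phi> y = j"
      unfolding \<phi>_def using ij bij by (auto simp: bij_betw_def intro: the_inv_into_f_f)
    have "adjacent H x y \<longleftrightarrow> adjacent G' x y"
      using xy by (simp add: H_def adjacent_induce)
    also have "\<dots> \<longleftrightarrow> j = Suc i \<or> i = Suc j"
    proof (rule linorder_cases[of i j])
      assume "i < j"
      then show ?thesis
        using induced_path_nth[OF path, of i j] ij
        by (auto simp: G'_def adjacent_foldl_local_complement)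
    next
      assume "j < i"
      then show ?thesis
        using induced_path_nth[OF path, of j i] ij adjacent_sym[of G' x y]
        by (auto simp: G'_def adjacent_foldl_local_complement)
    next
      assume "i = j"
      \<comment> \<open>On the diagonal both sides are false, since local complementation never
        creates loops.\<close>
      moreover have "irreflp (foldl local_complement_rel E us)" if "irreflp E"
        for E :: "'a \<Rightarrow> 'a \<Rightarrow> bool" and us
        using that by (induction us arbitrary: E) (auto simp: irreflp_local_complement_rel)
      ultimately show ?thesis
        using ij irreflp_adjacent[OF assms(1)]
        by (auto simp: G'_def adjacent_foldl_local_complement irreflp_def)
    qed
    also have "\<dots> \<longleftrightarrow> adjacent (path_graph (length xs)) (\<phi> x) (\<phi> y)"
      unfolding \<phi> adjacent_path_graph using ij(1,3) by blast
    finally show "adjacent H x y \<longleftrightarrow> adjacent (path_graph (length xs)) (\<phi> x) (\<phi> y)" .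
  qed
  ultimately show ?thesis by blast
qed

section \<open>The number of cographs and the linear bound\<close>

text \<open>Path length and sequence length are both taken to be \<open>t\<close>. The three
  outcomes then give an induced path on \<open>t\<close> vertices after no, one or \<open>t\<close>
  local complementations.\<close>

lemma path_vertex_minor_free_cograph_colorable:
  assumes "G \<in> vertex_minor_free_graphs (path_graph t)"
  shows "cograph_colorable (adjacent G) (verts G) (split_bound t t)"
proof (rule ccontr)
  assume neg: "\<not> ?thesis"
  have G: "fin_simple_graph G" "\<not> (\<exists>H. vertex_minor H G \<and> graph_iso H (path_graph t))"
    using assms by (auto simp: vertex_minor_free_graphs_def)
  have no: False if "set vs \<subseteq> verts G" "set xs \<subseteq> verts G"
    "induced_path (foldl local_complement_rel (adjacent G) vs) xs" "length xs = t" for vs xs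
    using vertex_minor_path_graph[OF G(1) that(1-3)] that(4) G(2) by simp
  have "finite (verts G)" using G(1) by (simp add: fin_simple_graph_def)
  from path_or_copath_or_alternating[OF this symp_adjacent irreflp_adjacent[OF G(1)] neg, where b = True]
  show False
  proof cases
    case (1 xs)
    then show False using no[of "[]" xs] by simp
  next
    case (2 v xs)
    then show False using no[of "[v]" xs] copath_local_complement_rel[of "adjacent G" xs v] by simp
  next
    case (3 xs)
    \<comment> \<open>The construction starts from the empty path and adds each new vertex at the
      front, hence \<open>rev xs\<close>.\<close>
    then show False
      using no[of xs "rev xs"]
        alternating_foldl_local_complement_rel[OF symp_adjacent irreflp_adjacent[OF G(1)], of xs "[]"] by simp
  qed
qed

theorem theorem5p3:
  fixes t :: nat
  assumes "t \<ge> 1"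
  shows "linearly_chi_bounded (vertex_minor_free_graphs (path_graph t) :: 'a graph set)"
proof -
  \<comment> \<open>The slope of the bounding function, which depends on \<open>t\<close>
    alone.\<close>
  define k where "k = split_bound t t"
  have "real (chromatic_number H) \<le> real k * real (clique_number H)"
    if GH: "G \<in> vertex_minor_free_graphs (path_graph t)" "induced_subgraph H G" for G H :: "'a graph"
  proof -
    obtain S where S: "S \<subseteq> verts G" "H = induce G S"
      using GH(2) by (auto simp: induced_subgraph_def)
    have G: "fin_simple_graph G" using GH(1) by (simp add: vertex_minor_free_graphs_def)
    have fin: "finite S" using S(1) G by (auto simp: fin_simple_graph_def intro: finite_subset)
    have vH: "verts H = S" by (simp add: S(2) induce_def)
    have aH: "adjacent H x y = adjacent G x y" if "x \<in> S" "y \<in> S" for x y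
      using adjacent_induce[OF that] S(2) by simp
    \<comment> \<open>The partition of \<open>G\<close> into cographs restricts to \<open>S\<close>,
      so the bound passes to every induced subgraph with the same \<open>k\<close>.\<close>
    have cc: "cograph_colorable (adjacent G) S k"
      unfolding k_def
      by (rule cograph_colorable_subset[OF path_vertex_minor_free_cograph_colorable[OF GH(1)] S(1)])
    have "card K \<le> clique_number H"
      if "finite K" "K \<subseteq> S" "\<forall>x\<in>K. \<forall>y\<in>K. x \<noteq> y \<longrightarrow> adjacent G x y" for K
      unfolding clique_number_def
    proof (rule Max_ge)
      have "{K. is_clique H K} \<subseteq> Pow S" by (auto simp: is_clique_def vH)
      then show "finite (card ` {K. is_clique H K})"
        using fin by (meson finite_Pow_iff finite_imageI finite_subset)
      show "card K \<in> card ` {K. is_clique H K}"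
        using that aH by (auto simp: is_clique_def vH subset_iff)
    qed
    from cograph_colorable_imp_coloring[OF cc symp_adjacent irreflp_adjacent[OF G] this]
    have "colorable H (k * clique_number H)"
      using aH by (simp add: colorable_def vH)
    then have "chromatic_number H \<le> k * clique_number H"
      unfolding chromatic_number_def by (rule Least_le)
    then show ?thesis by (metis of_nat_le_iff of_nat_mult)
  qed
  then show ?thesis
    unfolding linearly_chi_bounded_def chi_bounding_function_def
    by (intro exI[of _ "\<lambda>n. real k * real n"]) auto
qed

end
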